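(* Let $p,q\ge1$, $I=\{1,\dots,p\}$, $J=\{1,\dots,q\}$, let $\Omega_i$ ($i\in I$), $\Theta_j$ ($j\in J$) and $S$ be nonempty closed convex subsets of $\mathbb{R}^n$ with $\Omega_i\cap S=\emptyset$ for every $i\in I$, and let $\alpha_i$ ($i\in I$), $\beta_j$ ($j\in J$) and $\lambda$ be positive real numbers. Let $\{x_k\}_{k\ge0}$ be generated as follows: $x_0\in S$, and for each $k\ge0$, $$y_k=\sum_{j\in J}\beta_j w_j+\lambda x_k,\qquad x_{k+1}=\operatorname{argmin}_{x\in S}\Big\{\sum_{i\in I}\alpha_i d(x;\Omega_i)+\frac{\lambda}{2}\|x\|^2-\langle y_k,x\rangle\Big\},$$ where $w_j=\dfrac{x_k-P(x_k;\Theta_j)}{d(x_k;\Theta_j)}$ if $x_k\notin\Theta_j$ and $w_j=0$ otherwise. Suppose that at least one of the following conditions is satisfied: (i) $S$ is bounded; (ii) $\sum_{i\in I}\alpha_i>\sum_{j\in J}\beta_j$, and all the sets $\Omega_i$, $i\in I$, are bounded. Then any limit point of the sequence $\{x_k\}$ is a critical point of the problem $$\min\Big\{\sum_{i\in I}\alpha_i d(x;\Omega_i)+\delta(x;S)-\sum_{j\in J}\beta_j d(x;\Theta_j)\;\Big|\;x\in\mathbb{R}^n\Big\},$$ written as $\min\{g(x)-h(x)\;|\;x\in\mathbb{R}^n\}$ with $$g(x)=\sum_{i\in I}\alpha_i d(x;\Omega_i)+\frac{\lambda}{2}\|x\|^2+\delta(x;S),\qquad h(x)=\sum_{j\in J}\beta_j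 d(x;\Theta_j)+\frac{\lambda}{2}\|x\|^2.$$
   Context: $\mathbb{R}^n$ carries the Euclidean inner product $\langle\cdot,\cdot\rangle$ and norm $\|\cdot\|$. For a nonempty closed convex set $Q\subset\mathbb{R}^n$, $d(x;Q)=\inf\{\|x-w\|\;|\;w\in Q\}$, and $P(x;Q)$ is the Euclidean projection of $x$ to $Q$, i.e., the unique $w\in Q$ with $\|x-w\|=d(x;Q)$. $\delta(\cdot;S)$ is the indicator function: $\delta(x;S)=0$ if $x\in S$ and $\delta(x;S)=\infty$ otherwise. For a convex function $\varphi:\mathbb{R}^n\to(-\infty,\infty]$ and $\bar x$ with $\varphi(\bar x)<\infty$, the subdifferential $\partial\varphi(\bar x)$ is the set of all $v\in\mathbb{R}^n$ with $\langle v,x-\bar x\rangle\le\varphi(x)-\varphi(\bar x)$ for all $x\in\mathbb{R}^n$. A point $\bar x$ is a critical point of $\min\{g(x)-h(x)\;|\;x\in\mathbb{R}^n\}$ if $\partial g(\bar x)\cap\partial h(\bar x)\ne\emptyset$. *)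

theory Defs
  imports "HOL-Analysis.Analysis"
begin

text \<open>Not the library constant \<open>indicator\<close>: this one is 0 on the set and \<open>\<infinity>\<close> off it.\<close>

definition convex_indicator :: "'a set \<Rightarrow> 'a \<Rightarrow> ereal" where
  "convex_indicator S x = (if x \<in> S then 0 else \<infinity>)"

text \<open>The subdifferential is empty where \<open>\<phi>\<close> is not finite. The guard cannot be dropped:
  \<open>\<infinity> - \<infinity> = \<infinity>\<close> on \<^typ>\<open>ereal\<close>, so otherwise every vector would
  be a subgradient at points outside the domain.\<close>

definition subdifferential :: "('a::real_inner \<Rightarrow> ereal) \<Rightarrow> 'a \<Rightarrow> 'a set" where
  "subdifferential \<phi> z =
     {v. \<bar>\<phi> z\<bar> \<noteq> \<infinity> \<and> (\<forall>x. ereal (v \<bullet> (x - z)) \<le> \<phi> x - \<phi> z)}"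

text \<open>Criticality depends on the decomposition \<open>g - h\<close>, not only on the
  difference itself, hence the two arguments.\<close>

definition critical_point ::
  "('a::real_inner \<Rightarrow> ereal) \<Rightarrow> ('a \<Rightarrow> ereal) \<Rightarrow> 'a \<Rightarrow> bool" where
  "critical_point g h z \<longleftrightarrow> subdifferential g z \<inter> subdifferential h z \<noteq> {}"

text \<open>Limit of a subsequence. This is weaker than \<open>islimpt\<close> applied to the range: a constant
  sequence has its value as a limit point.\<close>

definition seq_limit_point :: "(nat \<Rightarrow> 'a::topological_space) \<Rightarrow> 'a \<Rightarrow> bool" where
  "seq_limit_point x z \<longleftrightarrow> (\<exists>r. strict_mono r \<and> (x \<circ> r) \<longlonglongrightarrow> z)"

end

theory Submission
  imports Defs
begin

text \<open>
  The iteration is the algorithm for differences of convex functions, and the argument has two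
  halves. Write \<open>G\<close> for the finite part of \<open>g\<close>, so that \<open>g = G + \<delta>(\<cdot>; S)\<close>. The vectors
  \<open>w\<^sub>j\<close> are subgradients of the distance functions (\<open>infdist_subgradient\<close>), so \<open>y\<^sub>k\<close> is a
  subgradient of \<open>h\<close> at \<open>x\<^sub>k\<close>; that \<open>x\<^sub>k\<^sub>+\<^sub>1\<close> minimizes \<open>G - \<langle>y\<^sub>k, \<cdot>\<rangle>\<close> over \<open>S\<close>
  says precisely that the same \<open>y\<^sub>k\<close> is a subgradient of \<open>g\<close> at \<open>x\<^sub>k\<^sub>+\<^sub>1\<close>. Thus \<open>y\<^sub>k\<close> is
  almost a common subgradient, and would be one in the limit if the step
  \<open>x\<^sub>k\<^sub>+\<^sub>1 - x\<^sub>k\<close> tends to zero.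

  The quadratic term makes this happen. It makes \<open>h\<close> strongly convex, so the
  subgradient inequality of \<open>h\<close> at \<open>x\<^sub>k\<close> has an extra \<open>\<lambda>/2 \<parallel>x\<^sub>k\<^sub>+\<^sub>1 - x\<^sub>k\<parallel>\<^sup>2\<close>, and adding it to
  the minimality of \<open>x\<^sub>k\<^sub>+\<^sub>1\<close> shows that the objective \<open>G - h\<close> drops by at least that amount in each
  step. Along a subsequence converging to \<open>z\<close> the objective converges by
  continuity; being monotone it then converges along the whole sequence, so the drops, and
  with them the steps, vanish (\<open>dca_steps_vanish\<close>). Finally, the \<open>y\<^sub>k\<close> along the
  subsequence are bounded (\<open>bounded_subgradients\<close>), and any accumulation point of
  them is a subgradient of both \<open>g\<close> and \<open>h\<close> at \<open>z\<close> (\<open>dca_common_subgradient\<close>).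
\<close>

text \<open>Off \<open>T\<close>, with \<open>P\<close> the projection of \<open>x\<close>, the inequality
  comes from the hyperplane through \<open>P\<close> orthogonal to \<open>x - P\<close>, which separates \<open>T\<close> from \<open>x\<close>: the
  distance of \<open>u\<close> to \<open>T\<close> is at least its signed distance to that hyperplane.\<close>

lemma infdist_subgradient:
  fixes T :: "'a::euclidean_space set" and x u :: 'a
  assumes "T \<noteq> {}" "closed T" "convex T"
  shows "(if x \<notin> T then (x - closest_point T x) /\<^sub>R infdist x T else 0) \<bullet> (u - x)
         \<le> infdist u T - infdist x T"
proof (cases "x \<in> T")
  case True
  then show ?thesis by (simp add: infdist_nonneg)
next
  case False
  define P where "P = closest_point T x"
  define c where "c = closest_point T u"
  have dx: "infdist x T = norm (x - P)" and du: "infdist u T = norm (u - c)"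
    using assms by (simp_all add: P_def c_def infdist_eq_setdist setdist_closest_point dist_norm)
  have pos: "norm (x - P) > 0"
    using False closest_point_in_set[OF assms(2,1), of x] by (auto simp: P_def)
  have sep: "(x - P) \<bullet> (c - P) \<le> 0"
    unfolding P_def c_def
    using assms by (intro closest_point_dot closest_point_in_set)
  have "(x - P) \<bullet> (u - x) = (x - P) \<bullet> (u - c) + (x - P) \<bullet> (c - P) - (x - P) \<bullet> (x - P)"
    by (simp add: algebra_simps)
  also have "\<dots> \<le> norm (x - P) * norm (u - c) - norm (x - P) * norm (x - P)"
    using sep norm_cauchy_schwarz[of "x - P" "u - c"]
    by (simp add: dot_square_norm power2_eq_square)
  finally have "(x - P) \<bullet> (u - x) \<le> (norm (u - c) - norm (x - P)) * norm (x - P)"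
    by (simp add: algebra_simps)
  then have "((x - P) \<bullet> (u - x)) / norm (x - P) \<le> norm (u - c) - norm (x - P)"
    using pos by (simp add: pos_divide_le_eq)
  then show ?thesis
    using False by (simp add: dx du P_def[symmetric] divide_inverse mult.commute)
qed

text \<open>A long subgradient forces a large increase of the function within distance one, which
  a function bounded on bounded sets does not allow.\<close>

lemma bounded_subgradients:
  fixes H :: "'a::euclidean_space \<Rightarrow> real" and x v :: "'i \<Rightarrow> 'a"
  assumes cont: "continuous_on UNIV H"
    and sub: "\<And>k u. v k \<bullet> (u - x k) \<le> H u - H (x k)"
    and bdd: "bounded (range x)"
  shows "bounded (range v)"
proof -
  obtain R where R: "\<And>k. norm (x k) \<le> R"
    using bdd by (auto simp: bounded_iff)
  have "bounded (H ` cball 0 (R + 1))"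
    using cont by (intro compact_imp_bounded compact_continuous_image)
      (auto intro: continuous_on_subset)
  then obtain M where "\<forall>t\<in>H ` cball 0 (R + 1). norm t \<le> M"
    unfolding bounded_iff by blast
  then have M: "\<bar>H u\<bar> \<le> M" if "norm u \<le> R + 1" for u
    using that by simp
  have "norm (v k) \<le> 2 * M" for k
  proof -
    \<comment> \<open>One step of length one in the direction of the subgradient; \<open>sgn 0 = 0\<close> covers \<open>v k = 0\<close>.\<close>
    define u where "u = x k + sgn (v k)"
    have "norm u \<le> norm (x k) + norm (sgn (v k))"
      unfolding u_def by (rule norm_triangle_ineq)
    also have "\<dots> \<le> R + 1" using R[of k] by (simp add: norm_sgn)
    finally have "\<bar>H u\<bar> \<le> M" by (rule M)
    moreover have "\<bar>H (x k)\<bar> \<le> M" using R[of k] by (intro M) simp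
    moreover have "v k \<bullet> (u - x k) = norm (v k)"
      by (cases "v k = 0") (simp_all add: u_def sgn_div_norm dot_square_norm power2_eq_square)
    ultimately show ?thesis using sub[of k u] by linarith
  qed
  then show ?thesis by (auto simp: bounded_iff)
qed

lemma decseq_tendsto_of_subseq:
  fixes F :: "nat \<Rightarrow> real"
  assumes "decseq F" "strict_mono r" "(F \<circ> r) \<longlonglongrightarrow> l"
  shows "F \<longlonglongrightarrow> l"
proof -
  have "l \<le> F n" for n
  proof -
    have "decseq (F \<circ> r)"
      using assms(1,2) by (auto simp: decseq_def strict_mono_less_eq)
    then have "l \<le> F (r n)"
      using decseq_ge[OF _ assms(3)] by (simp add: comp_def)
    also have "\<dots> \<le> F n"
      using assms(1) seq_suble[OF assms(2)] by (auto simp: decseq_def)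
    finally show ?thesis .
  qed
  then obtain L where L: "F \<longlonglongrightarrow> L"
    using decseq_convergent[OF assms(1)] by blast
  have "L = l"
    by (rule LIMSEQ_unique[OF LIMSEQ_subseq_LIMSEQ[OF L assms(2)] assms(3)])
  then show ?thesis using L by simp
qed

text \<open>Strong convexity of \<open>H\<close>, in the form of the term with \<open>c\<close>, bounds the square of each step by
  a multiple of the decrease of \<open>G - H\<close>. The
  existence of one limit point stands in for a lower bound on \<open>G - H\<close>.\<close>

lemma dca_steps_vanish:
  fixes G H :: "'a::real_inner \<Rightarrow> real" and x y :: "nat \<Rightarrow> 'a"
  assumes contG: "continuous_on UNIV G" and contH: "continuous_on UNIV H"
    and c: "c > 0"
    and subH: "\<And>k u. H (x k) + y k \<bullet> (u - x k) + c * (norm (u - x k))\<^sup>2 \<le> H u"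
    and desc: "\<And>k. G (x (Suc k)) - y k \<bullet> x (Suc k) \<le> G (x k) - y k \<bullet> x k"
    and r: "strict_mono r" and lim: "(x \<circ> r) \<longlonglongrightarrow> z"
  shows "(\<lambda>k. x (Suc k) - x k) \<longlonglongrightarrow> 0"
proof -
  define F where "F k = G (x k) - H (x k)" for k
  have drop: "c * (norm (x (Suc k) - x k))\<^sup>2 \<le> F k - F (Suc k)" for k
    using subH[of k "x (Suc k)"] desc[of k] by (simp add: F_def inner_diff_right)
  have "0 \<le> c * (norm (x (Suc k) - x k))\<^sup>2" for k
    using c by simp
  with drop have "F (Suc k) \<le> F k" for k
    by (meson diff_ge_0_iff_ge order_trans)
  then have "decseq F" by (rule decseq_SucI)
  moreover have "(F \<circ> r) \<longlonglongrightarrow> G z - H z"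
  proof -
    have "(\<lambda>k. G ((x \<circ> r) k)) \<longlonglongrightarrow> G z" "(\<lambda>k. H ((x \<circ> r) k)) \<longlonglongrightarrow> H z"
      using continuous_on_tendsto_compose[OF contG lim]
        continuous_on_tendsto_compose[OF contH lim] by simp_all
    then show ?thesis unfolding F_def comp_def by (rule tendsto_diff)
  qed
  ultimately have lF: "F \<longlonglongrightarrow> G z - H z"
    using r decseq_tendsto_of_subseq by blast
  have "(\<lambda>k. (F k - F (Suc k)) / c) \<longlonglongrightarrow> ((G z - H z) - (G z - H z)) / c"
    using c by (intro tendsto_divide tendsto_diff tendsto_const lF LIMSEQ_Suc[OF lF]) simp
  then have l0: "(\<lambda>k. (F k - F (Suc k)) / c) \<longlonglongrightarrow> 0" by simp
  have "norm ((norm (x (Suc k) - x k))\<^sup>2) \<le> (F k - F (Suc k)) / c" for k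
    using drop[of k] c by (simp add: pos_le_divide_eq mult.commute)
  then have "(\<lambda>k. (norm (x (Suc k) - x k))\<^sup>2) \<longlonglongrightarrow> 0"
    by (intro Lim_null_comparison[OF always_eventually l0] allI)
  then have "(\<lambda>k. sqrt ((norm (x (Suc k) - x k))\<^sup>2)) \<longlonglongrightarrow> sqrt 0"
    by (rule tendsto_real_sqrt)
  then show ?thesis by (simp add: tendsto_norm_zero_iff)
qed

text \<open>Both subgradient inequalities are closed under limits of base point and subgradient. The first
  one holds for \<open>y k\<close> at \<open>x (Suc k)\<close> and the second at \<open>x k\<close>, and vanishing steps make the two base
  points converge to the same \<open>z\<close>.\<close>

lemma dca_common_subgradient:
  fixes G H :: "'a::euclidean_space \<Rightarrow> real" and x y :: "nat \<Rightarrow> 'a"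
  assumes contG: "continuous_on UNIV G" and contH: "continuous_on UNIV H"
    and c: "c > 0" and clS: "closed S" and xS: "\<And>k. x k \<in> S"
    and subH: "\<And>k u. H (x k) + y k \<bullet> (u - x k) + c * (norm (u - x k))\<^sup>2 \<le> H u"
    and minG: "\<And>k u. u \<in> S \<Longrightarrow> G (x (Suc k)) - y k \<bullet> x (Suc k) \<le> G u - y k \<bullet> u"
    and r: "strict_mono r" and lim: "(x \<circ> r) \<longlonglongrightarrow> z"
  obtains v where "z \<in> S"
    and "\<And>u. u \<in> S \<Longrightarrow> v \<bullet> (u - z) \<le> G u - G z"
    and "\<And>u. v \<bullet> (u - z) \<le> H u - H z"
proof -
  have subH': "y k \<bullet> (u - x k) \<le> H u - H (x k)" for k u
    using subH[of k u] c by (smt (verit) mult_nonneg_nonneg zero_le_power2)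
  have "bounded (range (x \<circ> r))"
    using lim by (intro convergent_imp_bounded)
  then have "bounded (range (y \<circ> r))"
    using subH' by (intro bounded_subgradients[OF contH, of "y \<circ> r" "x \<circ> r"]) auto
  then obtain v s where s: "strict_mono s" and lv: "((y \<circ> r) \<circ> s) \<longlonglongrightarrow> v"
    using bounded_imp_convergent_subsequence by blast
  define t where "t = r \<circ> s"
  have t: "strict_mono t" unfolding t_def using r s by (rule strict_mono_o)
  have ly: "(\<lambda>k. y (t k)) \<longlonglongrightarrow> v"
    using lv by (simp add: t_def comp_def)
  have lx: "(\<lambda>k. x (t k)) \<longlonglongrightarrow> z"
    using LIMSEQ_subseq_LIMSEQ[OF lim s] by (simp add: t_def comp_def)
  have "(\<lambda>k. x (Suc k) - x k) \<longlonglongrightarrow> 0"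
    using contG contH c subH minG[OF xS] r lim by (rule dca_steps_vanish)
  from LIMSEQ_subseq_LIMSEQ[OF this t]
  have "(\<lambda>k. x (Suc (t k)) - x (t k)) \<longlonglongrightarrow> 0" by (simp add: comp_def)
  from tendsto_add[OF this lx] have lx': "(\<lambda>k. x (Suc (t k))) \<longlonglongrightarrow> z" by simp
  show thesis
  proof
    show "z \<in> S"
      using closed_sequentially[OF clS _ lx] xS by blast
  next
    fix u assume u: "u \<in> S"
    have "(\<lambda>k. G (x (Suc (t k)))) \<longlonglongrightarrow> G z"
      using continuous_on_tendsto_compose[OF contG lx'] by simp
    then have lG: "(\<lambda>k. G u - G (x (Suc (t k)))) \<longlonglongrightarrow> G u - G z"
      by (intro tendsto_intros)
    have lyx: "(\<lambda>k. y (t k) \<bullet> (u - x (Suc (t k)))) \<longlonglongrightarrow> v \<bullet> (u - z)"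
      by (intro tendsto_intros ly lx')
    have "y (t k) \<bullet> (u - x (Suc (t k))) \<le> G u - G (x (Suc (t k)))" for k
      using minG[OF u, of "t k"] by (simp add: inner_diff_right)
    then show "v \<bullet> (u - z) \<le> G u - G z"
      by (intro LIMSEQ_le[OF lyx lG]) simp
  next
    fix u
    have "(\<lambda>k. H (x (t k))) \<longlonglongrightarrow> H z"
      using continuous_on_tendsto_compose[OF contH lx] by simp
    then have lH: "(\<lambda>k. H u - H (x (t k))) \<longlonglongrightarrow> H u - H z"
      by (intro tendsto_intros)
    have lyx: "(\<lambda>k. y (t k) \<bullet> (u - x (t k))) \<longlonglongrightarrow> v \<bullet> (u - z)"
      by (intro tendsto_intros ly lx)
    show "v \<bullet> (u - z) \<le> H u - H z"
      by (rule LIMSEQ_le[OF lyx lH]) (simp add: subH')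
  qed
qed

theorem theorem5p3:
  fixes p q :: nat
    and \<Omega> \<Theta> :: "nat \<Rightarrow> (real ^ 'n) set"
    and S :: "(real ^ 'n) set"
    and \<alpha> \<beta> :: "nat \<Rightarrow> real"
    and lam :: real
    and x y :: "nat \<Rightarrow> real ^ 'n"
    and w :: "nat \<Rightarrow> nat \<Rightarrow> real ^ 'n"
    and f g h :: "real ^ 'n \<Rightarrow> ereal"
  assumes "p \<ge> 1" and "q \<ge> 1"
    and "\<forall>i\<in>{1..p}. \<Omega> i \<noteq> {} \<and> closed (\<Omega> i) \<and> convex (\<Omega> i)"
    and "\<forall>j\<in>{1..q}. \<Theta> j \<noteq> {} \<and> closed (\<Theta> j) \<and> convex (\<Theta> j)"
    and "S \<noteq> {}" and "closed S" and "convex S"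
    and "\<forall>i\<in>{1..p}. \<Omega> i \<inter> S = {}"
    and "\<forall>i\<in>{1..p}. \<alpha> i > 0"
    and "\<forall>j\<in>{1..q}. \<beta> j > 0"
    and "lam > 0"
    and "x 0 \<in> S"
    and "\<forall>k. \<forall>j\<in>{1..q}. w k j =
           (if x k \<notin> \<Theta> j
            then (x k - closest_point (\<Theta> j) (x k)) /\<^sub>R infdist (x k) (\<Theta> j)
            else 0)"
    and "\<forall>k. y k = (\<Sum>j\<in>{1..q}. \<beta> j *\<^sub>R w k j) + lam *\<^sub>R x k"
    and "\<forall>k. is_arg_min
           (\<lambda>u. (\<Sum>i\<in>{1..p}. \<alpha> i * infdist u (\<Omega> i)) + lam / 2 * (norm u)\<^sup>2 - y k \<bullet> u)
           (\<lambda>u. u \<in> S) (x (Suc k))"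
    and "bounded S \<or>
         ((\<Sum>i\<in>{1..p}. \<alpha> i) > (\<Sum>j\<in>{1..q}. \<beta> j) \<and> (\<forall>i\<in>{1..p}. bounded (\<Omega> i)))"
    and "f = (\<lambda>u. ereal (\<Sum>i\<in>{1..p}. \<alpha> i * infdist u (\<Omega> i)) + convex_indicator S u
                - ereal (\<Sum>j\<in>{1..q}. \<beta> j * infdist u (\<Theta> j)))"
    and "g = (\<lambda>u. ereal ((\<Sum>i\<in>{1..p}. \<alpha> i * infdist u (\<Omega> i)) + lam / 2 * (norm u)\<^sup>2)
                + convex_indicator S u)"
    and "h = (\<lambda>u. ereal ((\<Sum>j\<in>{1..q}. \<beta> j * infdist u (\<Theta> j)) + lam / 2 * (norm u)\<^sup>2))"
  shows "(\<forall>u. f u = g u - h u) \<and> (\<forall>z. seq_limit_point x z \<longrightarrow> critical_point g h z)"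
proof (intro conjI allI impI)
  note T = assms(4) and x0 = assms(12) and w = assms(13) and y = assms(14) and amin = assms(15)
    and f = assms(17) and g = assms(18) and h = assms(19)
  show "f u = g u - h u" for u
    by (cases "u \<in> S") (simp_all add: f g h convex_indicator_def)
  fix z assume "seq_limit_point x z"
  then obtain r where r: "strict_mono r" and lim: "(x \<circ> r) \<longlonglongrightarrow> z"
    by (auto simp: seq_limit_point_def)
  define G where "G u = (\<Sum>i\<in>{1..p}. \<alpha> i * infdist u (\<Omega> i)) + lam / 2 * (norm u)\<^sup>2" for u
  define H where "H u = (\<Sum>j\<in>{1..q}. \<beta> j * infdist u (\<Theta> j)) + lam / 2 * (norm u)\<^sup>2" for u
  have contG: "continuous_on UNIV G" and contH: "continuous_on UNIV H"
    unfolding G_def H_def by (intro continuous_intros)+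
  have xS: "x k \<in> S" for k
    using x0 amin by (cases k) (auto simp: is_arg_min_def)
  have minG: "G (x (Suc k)) - y k \<bullet> x (Suc k) \<le> G u - y k \<bullet> u" if "u \<in> S" for k u
    using amin that by (auto simp: is_arg_min_linorder G_def)
  have subH: "H (x k) + y k \<bullet> (u - x k) + lam / 2 * (norm (u - x k))\<^sup>2 \<le> H u" for k u
  proof -
    have "(\<Sum>j\<in>{1..q}. \<beta> j *\<^sub>R w k j) \<bullet> (u - x k)
          = (\<Sum>j\<in>{1..q}. \<beta> j * (w k j \<bullet> (u - x k)))"
      by (simp add: inner_sum_left)
    also have "\<dots> \<le> (\<Sum>j\<in>{1..q}. \<beta> j * (infdist u (\<Theta> j) - infdist (x k) (\<Theta> j)))"
    proof (intro sum_mono mult_left_mono)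
      fix j assume j: "j \<in> {1..q}"
      then show "w k j \<bullet> (u - x k) \<le> infdist u (\<Theta> j) - infdist (x k) (\<Theta> j)"
        using infdist_subgradient[of "\<Theta> j" "x k" u] T w by simp
      show "0 \<le> \<beta> j" using assms(10) j by (simp add: less_imp_le)
    qed
    finally have dist: "(\<Sum>j\<in>{1..q}. \<beta> j *\<^sub>R w k j) \<bullet> (u - x k)
        \<le> (\<Sum>j\<in>{1..q}. \<beta> j * infdist u (\<Theta> j)) - (\<Sum>j\<in>{1..q}. \<beta> j * infdist (x k) (\<Theta> j))"
      by (simp add: right_diff_distrib sum_subtractf)
    have quad: "lam * (x k \<bullet> (u - x k)) + lam / 2 * (norm (u - x k))\<^sup>2
        = lam / 2 * (norm u)\<^sup>2 - lam / 2 * (norm (x k))\<^sup>2"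
      by (simp add: power2_norm_eq_inner inner_diff_left inner_diff_right inner_commute
          field_simps)
    have "y k \<bullet> (u - x k)
        = (\<Sum>j\<in>{1..q}. \<beta> j *\<^sub>R w k j) \<bullet> (u - x k) + lam * (x k \<bullet> (u - x k))"
      by (simp add: y inner_add_left)
    then show ?thesis
      using dist quad unfolding H_def by linarith
  qed
  have lam2: "lam / 2 > 0" using assms(11) by simp
  obtain v where zS: "z \<in> S"
    and vG: "\<And>u. u \<in> S \<Longrightarrow> v \<bullet> (u - z) \<le> G u - G z"
    and vH: "\<And>u. v \<bullet> (u - z) \<le> H u - H z"
    by (rule dca_common_subgradient[OF contG contH lam2 assms(6) xS subH minG r lim]) (assumption, rule that)
  have g': "g u = (if u \<in> S then ereal (G u) else \<infinity>)" for u
    by (simp add: g G_def convex_indicator_def)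
  have h': "h u = ereal (H u)" for u
    by (simp add: h H_def)
  have "v \<in> subdifferential g z"
    using zS vG by (auto simp: subdifferential_def g')
  moreover have "v \<in> subdifferential h z"
    using vH by (simp add: subdifferential_def h')
  ultimately show "critical_point g h z"
    by (auto simp: critical_point_def)
qed

end
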